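(* Let $n \geq 4$ be an integer and let $\mathcal{V}^{\bullet}_n$ be the $n$-th pinched Veronese poset. For every $\mathbf{z} \in \mathcal{V}^{\bullet}_n$, the interval $[\mathbf{0},\mathbf{z}]$ in $\mathcal{V}^{\bullet}_n$ is a shellable poset, where $\mathbf{0}=(0,\dots,0)$ is the zero vector of length $n$.
   Context: Let $\mathbb{N}_0$ be the non-negative integers and $\mathbf{j}=(1,\dots,1)\in\mathbb{N}_0^n$. The $n$-th pinched Veronese poset $(\mathcal{V}^{\bullet}_n,\preceq)$ has ground set $\{\mathbf{a}\in\mathbb{N}_0^n : \text{the coordinate sum of } \mathbf{a} \text{ is divisible by } n,\ \mathbf{a}\neq \mathbf{j}\}$, and $\mathbf{a}\preceq\mathbf{b}$ iff $\mathbf{a}\le\mathbf{b}$ coordinatewise and $\mathbf{b}-\mathbf{a}\neq\mathbf{j}$ (equivalently, $\mathbf{b}-\mathbf{a}\in\mathcal{V}^{\bullet}_n$). A finite bounded graded poset is shellable if its maximal chains admit a linear order such that whenever a maximal chain $c'$ precedes a maximal chain $c$, there is a maximal chain $c^*$ preceding $c$ with $c\cap c^*\supseteq c\cap c'$ and $|c\,\Delta\, c^*|=2$ (i.e., $c$ and $c^*$ differ in exactly one element); equivalently its order complex is shellable. *)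

theory Defs
  imports Main "HOL-Library.Function_Algebras"
begin

text \<open>
  A poset is given by a carrier \<open>A\<close> and an order relation \<open>r\<close> with
  \<^const>\<open>partial_order_on\<close> \<open>A r\<close>; since \<open>r\<close> is then reflexive exactly on \<open>A\<close>,
  every member of \<^const>\<open>Chains\<close> \<open>r\<close> is a subset of \<open>A\<close>.
\<close>

definition maximal_chains :: "'a rel \<Rightarrow> 'a set set" where
  "maximal_chains r = {C \<in> Chains r. \<forall>D \<in> Chains r. C \<subseteq> D \<longrightarrow> D = C}"

definition bounded_poset :: "'a set \<Rightarrow> 'a rel \<Rightarrow> bool" where
  "bounded_poset A r \<longleftrightarrow> partial_order_on A r \<and>
     (\<exists>bot\<in>A. \<forall>x\<in>A. (bot, x) \<in> r) \<and> (\<exists>top\<in>A. \<forall>x\<in>A. (x, top) \<in> r)"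

text \<open>For finite posets: graded means that all maximal chains have the same length.\<close>

definition graded_poset :: "'a set \<Rightarrow> 'a rel \<Rightarrow> bool" where
  "graded_poset A r \<longleftrightarrow> partial_order_on A r \<and>
     (\<forall>C \<in> maximal_chains r. \<forall>D \<in> maximal_chains r. card C = card D)"

definition shelling_order :: "'a rel \<Rightarrow> 'a set rel \<Rightarrow> bool" where
  "shelling_order r L \<longleftrightarrow> linear_order_on (maximal_chains r) L \<and>
     (\<forall>c' \<in> maximal_chains r. \<forall>c \<in> maximal_chains r. (c', c) \<in> L \<and> c' \<noteq> c \<longrightarrow>
        (\<exists>d \<in> maximal_chains r. (d, c) \<in> L \<and> d \<noteq> c \<and>
           c \<inter> c' \<subseteq> c \<inter> d \<and> card (sym_diff c d) = 2))"

definition shellable_poset :: "'a set \<Rightarrow> 'a rel \<Rightarrow> bool" where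
  "shellable_poset A r \<longleftrightarrow>
     finite A \<and> bounded_poset A r \<and> graded_poset A r \<and> (\<exists>L. shelling_order r L)"

definition order_interval :: "'a rel \<Rightarrow> 'a \<Rightarrow> 'a \<Rightarrow> 'a set" where
  "order_interval r x y = {w. (x, w) \<in> r \<and> (w, y) \<in> r}"

text \<open>
  A vector of length \<open>n\<close> over the non-negative integers is encoded as a function on
  \<^typ>\<open>nat\<close> that vanishes outside the coordinates \<open>{..<n}\<close>.  Then \<open>\<le>\<close>, \<open>-\<close> and \<open>0\<close> on
  functions are the coordinatewise notions.
\<close>

definition nat_vectors :: "nat \<Rightarrow> (nat \<Rightarrow> nat) set" where
  "nat_vectors n = {a. \<forall>i\<ge>n. a i = 0}"

definition all_ones :: "nat \<Rightarrow> nat \<Rightarrow> nat" where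
  "all_ones n = (\<lambda>i. if i < n then 1 else 0)"

definition pinched_veronese :: "nat \<Rightarrow> (nat \<Rightarrow> nat) set" where
  "pinched_veronese n = {a \<in> nat_vectors n. n dvd (\<Sum>i<n. a i) \<and> a \<noteq> all_ones n}"

text \<open>The truncated subtraction \<open>b - a\<close> is only used under \<open>a \<le> b\<close>, where it is exact.\<close>

definition pinched_veronese_order :: "nat \<Rightarrow> (nat \<Rightarrow> nat) rel" where
  "pinched_veronese_order n =
     relation_of (\<lambda>a b. a \<le> b \<and> b - a \<noteq> all_ones n) (pinched_veronese n)"

end

theory Submission
  imports Defs "HOL-Library.Product_Lexorder"
begin

text \<open>
  Maximal chains of \<open>[0, z]\<close> are words in the vectors of degree one (coordinate sum \<open>n\<close>, not
  all ones).  Such a vector has a coordinate at least \<open>2\<close>, so it can be written as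
  \<open>2 e\<^sub>i + u\<close> with \<open>i\<close> least possible (\<open>i\<close> is \<open>idx\<close>, \<open>u\<close> is \<open>rest\<close>); this is the
  presentation of the pinched Veronese ring as a diagonal subalgebra of the Rees algebra of the
  complete intersection \<open>(x\<^sub>1\<^sup>2, \<dots>, x\<^sub>n\<^sup>2)\<close>.  A word is normal if the \<open>i\<close>'s increase weakly,
  the blocks \<open>u\<close> (viewed as multisets of \<open>n - 2\<close> letters) decrease weakly, and no letter below the
  last \<open>i\<close> occurs twice among all the blocks.  A normal word is determined by its sum, and for
  \<open>n \<ge> 4\<close> normality can be tested on consecutive pairs: two blocks have \<open>2 n - 4 \<ge> n\<close>
  letters, so they cannot consist of distinct letters below some \<open>i < n\<close>, and hence all small
  letters sit in the last two blocks.  Every pair that is not normal admits an elementary exchange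
  that lowers a suitable key.  Order the chains by that key.  If no exchange outside
  \<open>c \<inter> c'\<close> lowers the key of \<open>c\<close>, then \<open>c\<close> is normal between consecutive elements of
  \<open>c \<inter> c'\<close>, so it is the unique minimum among the chains containing \<open>c \<inter> c'\<close>; therefore
  \<open>c'\<close> cannot precede \<open>c\<close>.
\<close>

section \<open>Degree-one vectors, their indices and their blocks\<close>

definition gens :: "nat \<Rightarrow> (nat \<Rightarrow> nat) set" where
  "gens n = {a \<in> nat_vectors n. sum a {..<n} = n \<and> a \<noteq> all_ones n}"

definition idx :: "(nat \<Rightarrow> nat) \<Rightarrow> nat" where
  "idx a = (LEAST l. 2 \<le> a l)"

definition rest :: "(nat \<Rightarrow> nat) \<Rightarrow> nat \<Rightarrow> nat" where
  "rest a = (\<lambda>l. a l - (if l = idx a then 2 else 0))"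

text \<open>A linear statistic that grows when letters move to larger coordinates; it detects the
  sorting of letters between blocks.\<close>

definition wt :: "nat \<Rightarrow> (nat \<Rightarrow> nat) \<Rightarrow> nat" where
  "wt n a = (\<Sum>l<n. l * a l)"

definition descending :: "(nat \<Rightarrow> nat) \<Rightarrow> (nat \<Rightarrow> nat) \<Rightarrow> bool" where
  "descending a b \<longleftrightarrow> idx a \<le> idx b \<and> (\<forall>l l'. 0 < rest a l \<longrightarrow> 0 < rest b l' \<longrightarrow> l' \<le> l)"

definition good :: "(nat \<Rightarrow> nat) \<Rightarrow> (nat \<Rightarrow> nat) \<Rightarrow> bool" where
  "good a b \<longleftrightarrow> descending a b \<and> (\<forall>l < idx b. rest a l + rest b l \<le> 1)"

text \<open>\<open>move l m c a\<close> is \<open>a - c e\<^sub>l + c e\<^sub>m\<close>; it is meant for \<open>l \<noteq> m\<close> and \<open>c \<le> a l\<close>.\<close>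

definition move :: "nat \<Rightarrow> nat \<Rightarrow> nat \<Rightarrow> (nat \<Rightarrow> nat) \<Rightarrow> nat \<Rightarrow> nat" where
  "move l l' c a = a(l := a l - c, l' := a l' + c)"

lemma vector_eqI:
  assumes "a \<in> nat_vectors n" "b \<in> nat_vectors n" "a \<le> b" "sum a {..<n} = sum b {..<n}"
  shows "a = b"
proof
  fix i
  have "a i = b i" if "i < n"
    using sum_mono_inv[of a "{..<n}" b i] assms that by (auto simp: le_fun_def)
  then show "a i = b i"
    using assms by (cases "i < n") (auto simp: nat_vectors_def)
qed

lemma sum_all_ones [simp]: "sum (all_ones n) {..<n} = n"
  by (simp add: all_ones_def)

lemma all_ones_nat_vectors [simp]: "all_ones n \<in> nat_vectors n"
  by (simp add: all_ones_def nat_vectors_def)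

text \<open>Entries at most 1 with sum \<open>n\<close> leave only the excluded all-ones vector.
  This is what makes the least coordinate in \<open>idx\<close> exist.\<close>

lemma gens_idx_exists:
  assumes "a \<in> gens n"
  shows "\<exists>l. 2 \<le> a l"
proof (rule ccontr)
  assume "\<nexists>l. 2 \<le> a l"
  then have "a i \<le> 1" for i
    by (metis not_less_eq_eq numeral_2_eq_2 One_nat_def)
  then have "a \<le> all_ones n"
    using assms by (auto simp: le_fun_def gens_def nat_vectors_def all_ones_def not_less)
  then have "a = all_ones n"
    using assms by (intro vector_eqI[of _ n]) (auto simp: gens_def)
  then show False
    using assms by (simp add: gens_def)
qed

lemma idx_ge_2: "a \<in> gens n \<Longrightarrow> 2 \<le> a (idx a)"
  unfolding idx_def using gens_idx_exists by (metis (mono_tags, lifting) LeastI_ex)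

lemma idx_le: "2 \<le> a l \<Longrightarrow> idx a \<le> l"
  unfolding idx_def by (rule Least_le)

lemma idx_less: "a \<in> gens n \<Longrightarrow> idx a < n"
  using idx_ge_2[of a n] by (cases "idx a < n") (auto simp: gens_def nat_vectors_def)

lemma gens_less: "a \<in> gens n \<Longrightarrow> 0 < a l \<Longrightarrow> l < n"
  by (cases "l < n") (auto simp: gens_def nat_vectors_def)

lemma gensI: "a \<in> nat_vectors n \<Longrightarrow> sum a {..<n} = n \<Longrightarrow> 2 \<le> a l \<Longrightarrow> a \<in> gens n"
  by (auto simp: gens_def all_ones_def split: if_splits)

lemma rest_eq: "a \<in> gens n \<Longrightarrow> a l = rest a l + (if l = idx a then 2 else 0)"
  using idx_ge_2[of a n] by (auto simp: rest_def)

lemma rest_le_1: "l < idx a \<Longrightarrow> rest a l \<le> 1"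
  using idx_le[of a l] by (force simp: rest_def)

lemma sum_rest:
  assumes "a \<in> gens n"
  shows "sum (rest a) {..<n} + 2 = n"
proof -
  have "n = (\<Sum>l<n. a l)"
    using assms by (simp add: gens_def)
  also have "\<dots> = (\<Sum>l<n. rest a l + (if l = idx a then 2 else 0))"
    using rest_eq[OF assms] by (intro sum.cong) auto
  also have "\<dots> = sum (rest a) {..<n} + 2"
    using idx_less[OF assms] by (simp add: sum.distrib)
  finally show ?thesis
    by simp
qed

lemma rest_outside: "a \<in> gens n \<Longrightarrow> n \<le> l \<Longrightarrow> rest a l = 0"
  by (auto simp: rest_def gens_def nat_vectors_def)

lemma rest_nonempty:
  assumes "a \<in> gens n" "3 \<le> n"
  shows "\<exists>l. 0 < rest a l"
proof (rule ccontr)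
  assume "\<nexists>l. 0 < rest a l"
  then have "sum (rest a) {..<n} = 0"
    by simp
  then show False
    using sum_rest[OF assms(1)] assms(2) by simp
qed

section \<open>Moving letters between coordinates\<close>

lemma sum_move:
  fixes f :: "nat \<Rightarrow> nat"
  assumes "l \<noteq> l'" "l < n" "l' < n" "c \<le> a l"
  shows "(\<Sum>i<n. f i * move l l' c a i) + c * f l = (\<Sum>i<n. f i * a i) + c * f l'"
proof -
  let ?S = "{..<n} - {l} - {l'}"
  have split: "(\<Sum>i<n. f i * g i) = f l * g l + (f l' * g l' + (\<Sum>i\<in>?S. f i * g i))" for g :: "nat \<Rightarrow> nat"
    using assms by (simp add: sum.remove[of "{..<n}" l] sum.remove[of "{..<n} - {l}" l'])
  have "(\<Sum>i\<in>?S. f i * move l l' c a i) = (\<Sum>i\<in>?S. f i * a i)"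
    by (intro sum.cong) (auto simp: move_def)
  moreover have "f l * (a l - c) + c * f l = f l * a l"
    using assms(4) by (metis add_mult_distrib2 le_add_diff_inverse2 mult.commute)
  ultimately show ?thesis
    using assms(1) unfolding split by (simp add: move_def algebra_simps)
qed

lemma move_gens:
  assumes "a \<in> gens n" "l \<noteq> l'" "l' < n" "0 < c" "c \<le> a l" "2 \<le> move l l' c a p"
  shows "move l l' c a \<in> gens n"
proof (rule gensI)
  have "l < n"
    using assms gens_less by force
  then show "sum (move l l' c a) {..<n} = n"
    using sum_move[of l l' n c a "\<lambda>_. 1"] assms by (simp add: gens_def)
  show "move l l' c a \<in> nat_vectors n"
    using assms \<open>l < n\<close> by (auto simp: move_def gens_def nat_vectors_def)
qed fact

lemma move_add: "l \<noteq> l' \<Longrightarrow> c \<le> a l \<Longrightarrow> c \<le> b l' \<Longrightarrow> move l l' c a + move l' l c b = a + b"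
  by (auto simp: move_def fun_eq_iff)

lemma wt_move:
  assumes "a \<in> gens n" "l < l'" "l' < n" "0 < c" "c \<le> a l"
  shows "wt n a < wt n (move l l' c a)"
proof -
  have "wt n (move l l' c a) + c * l = wt n a + c * l'"
    using sum_move[of l l' n c a "\<lambda>i. i"] assms by (simp add: wt_def)
  moreover have "c * l < c * l'"
    using assms by simp
  ultimately show ?thesis
    by linarith
qed

text \<open>Only letters of the block are taken away, so two copies at \<open>idx a\<close> survive
  and the index cannot rise.\<close>

lemma move_idx_ge_2: "a \<in> gens n \<Longrightarrow> c \<le> rest a l \<Longrightarrow> 2 \<le> move l l' c a (idx a)"
  using idx_ge_2[of a n] by (auto simp: move_def rest_def split: if_splits)

subsection \<open>Normal words\<close>

text \<open>The three alternatives answer the three ways to fail \<open>good\<close>. A letter below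
  \<open>idx b\<close> that occurs twice is collected in \<open>b\<close> and becomes its index;
  indices in the wrong order are swapped; letters in the wrong order are exchanged, which makes
  \<open>a\<close> heavier.\<close>

lemma bad_pair_improves:
  assumes ab: "a \<in> gens n" "b \<in> gens n" and bad: "\<not> good a b"
  shows "\<exists>a'\<in>gens n. \<exists>b'\<in>gens n. a' + b' = a + b \<and>
    (idx a' \<le> idx a \<and> idx b' < idx b \<or>
     idx a' = idx b \<and> idx b' = idx a \<and> idx b < idx a \<or>
     idx a' \<le> idx a \<and> idx b' \<le> idx b \<and> wt n a < wt n a')"
proof -
  have rest_le: "rest c l \<le> c l" for c l
    by (simp add: rest_def)
  consider (swap) "idx b < idx a"
    | (square) l where "l < idx b" "2 \<le> rest a l + rest b l"
    | (sort) l l' where "l < l'" "0 < rest a l" "0 < rest b l'"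
    using bad unfolding good_def descending_def by (force simp: not_le)
  then show ?thesis
  proof cases
    case swap
    then show ?thesis
      using ab by (intro bexI[of _ b] bexI[of _ a]) (auto simp: add.commute)
  next
    case square
    have "rest b l \<le> 1"
      using rest_le_1 square by blast
    moreover have "b l = rest b l"
      using square by (simp add: rest_def)
    ultimately obtain c where c: "c = 1 \<or> c = 2" "c \<le> rest a l" "2 \<le> b l + c"
      using square by (cases "rest b l = 0") force+
    \<comment> \<open>Copies of \<open>l\<close> pass from \<open>a\<close> to \<open>b\<close> so that \<open>l\<close> becomes a possible index of \<open>b\<close>.\<close>
    let ?a = "move l (idx b) c a" and ?b = "move (idx b) l c b"
    have le: "c \<le> a l" "c \<le> b (idx b)" "l \<noteq> idx b" "0 < c" "l < n"
      using c rest_le[of a l] idx_ge_2[OF ab(2)] square idx_less[OF ab(2)] by auto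
    have a2: "2 \<le> ?a (idx a)"
      using c ab by (intro move_idx_ge_2)
    have b2: "2 \<le> ?b l"
      using c by (simp add: move_def)
    have "?a \<in> gens n" "?b \<in> gens n"
      using ab le idx_less[OF ab(2)]
      by (auto intro!: move_gens[OF _ _ _ _ _ a2] move_gens[OF _ _ _ _ _ b2])
    moreover have "?a + ?b = a + b"
      using le by (intro move_add) auto
    moreover have "idx ?a \<le> idx a" "idx ?b < idx b"
      using idx_le[of ?a "idx a"] a2 idx_le[of ?b l] b2 square by auto
    ultimately show ?thesis
      by blast
  next
    case sort
    let ?a = "move l l' 1 a" and ?b = "move l' l 1 b"
    have le: "1 \<le> a l" "1 \<le> b l'"
      using sort rest_le[of a l] rest_le[of b l'] by auto
    have less: "l' < n" "l < n"
      using gens_less[OF ab(2), of l'] le sort by auto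
    have a2: "2 \<le> ?a (idx a)" and b2: "2 \<le> ?b (idx b)"
      using sort ab by (auto intro!: move_idx_ge_2)
    have "?a \<in> gens n" "?b \<in> gens n"
      using move_gens[OF ab(1) _ less(1) _ le(1) a2] move_gens[OF ab(2) _ less(2) _ le(2) b2] sort
      by simp_all
    moreover have "?a + ?b = a + b"
      using le sort by (intro move_add) auto
    moreover have "wt n a < wt n ?a"
      using wt_move[of a n l l' 1] ab le less sort by simp
    ultimately show ?thesis
      using idx_le[of ?a "idx a"] a2 idx_le[of ?b "idx b"] b2 by blast
  qed
qed

text \<open>For the empty word \<open>last\<close> is unspecified, but the sum is then empty and the
  condition holds anyway.\<close>

definition normal_word :: "(nat \<Rightarrow> nat) list \<Rightarrow> bool" where
  "normal_word as \<longleftrightarrow> sorted_wrt descending as \<and>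
     (\<forall>l < idx (last as). (\<Sum>a\<leftarrow>as. rest a l) \<le> 1)"

text \<open>Passage from consecutive pairs to the whole word. Some letter of the second last block
  lies at or above the last index, and it bounds all letters of earlier blocks from below; so the
  letter condition concerns the last two blocks only.\<close>

lemma normal_wordI:
  assumes n: "4 \<le> n" and "set as \<subseteq> gens n" "successively good as"
  shows "normal_word as"
proof -
  have desc: "sorted_wrt descending as"
  proof -
    have "successively descending as"
      by (rule successively_mono[OF assms(3)]) (simp add: good_def)
    \<comment> \<open>An empty middle block would break transitivity; blocks of members of
      \<open>gens n\<close> have \<open>n - 2 > 0\<close> letters.\<close>
    moreover have "descending x z" if xyz: "x \<in> set as" "y \<in> set as" "z \<in> set as" "descending x y" "descending y z" for x y z
    proof -
      have "y \<in> gens n"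
        using xyz(2) assms(2) by blast
      then obtain l where "0 < rest y l"
        using rest_nonempty[of y n] n by auto
      then show ?thesis
        using xyz unfolding descending_def by (meson order_trans)
    qed
    ultimately show ?thesis
      using successively_iff_sorted_wrt_strong[of as descending] by blast
  qed
  have "(\<Sum>a\<leftarrow>as. rest a l) \<le> 1" if l: "l < idx (last as)" for l
  proof (cases as rule: rev_cases)
    case (snoc as' b)
    note as = snoc
    show ?thesis
    proof (cases as' rule: rev_cases)
      case Nil
      then show ?thesis
        using as l rest_le_1 by simp
    next
      case (snoc p a)
      have ab: "a \<in> gens n" "b \<in> gens n"
        using assms(2) as snoc by auto
      have "good a b"
        using assms(3) as snoc by (simp add: successively_append_iff)
      \<comment> \<open>Otherwise all letters of \<open>a\<close>, hence also the smaller ones of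
        \<open>b\<close>, lie below \<open>idx b < n\<close> and are distinct by
        \<open>good a b\<close>, although there are \<open>2 * n - 4 \<ge> n\<close> of
        them.\<close>
      have "\<exists>m \<ge> idx b. 0 < rest a m"
      proof (rule ccontr)
        assume contra: "\<not> ?thesis"
        obtain m where "0 < rest a m"
          using rest_nonempty[OF ab(1)] n by auto
        then have small: "rest a m = 0" "rest b m = 0" if "idx b \<le> m" for m
          using contra that \<open>good a b\<close> unfolding good_def descending_def
          by (auto simp: not_less) (metis le_trans not_gr0)
        have "sum (rest a) {..<n} + sum (rest b) {..<n} = (\<Sum>m<n. rest a m + rest b m)"
          by (simp add: sum.distrib)
        also have "\<dots> = (\<Sum>m<idx b. rest a m + rest b m)"
          using idx_less[OF ab(2)] small by (intro sum.mono_neutral_right) auto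
        also have "\<dots> \<le> (\<Sum>m<idx b. 1)"
          using \<open>good a b\<close> by (intro sum_mono) (auto simp: good_def)
        also have "\<dots> < n"
          using idx_less[OF ab(2)] by simp
        finally show False
          using sum_rest[OF ab(1)] sum_rest[OF ab(2)] n by linarith
      qed
      then obtain m where m: "idx b \<le> m" "0 < rest a m"
        by blast
      have "rest c l = 0" if "c \<in> set p" for c
      proof -
        have "descending c a"
          using desc as snoc that by (auto simp: sorted_wrt_append)
        then show ?thesis
          using m l as unfolding descending_def by (metis gr0I leD last_snoc le_trans)
      qed
      then have "(\<Sum>c\<leftarrow>p. rest c l) = 0"
        by (induction p) auto
      moreover have "(\<Sum>c\<leftarrow>as. rest c l) = (\<Sum>c\<leftarrow>p. rest c l) + (rest a l + rest b l)"
        by (simp add: as snoc)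
      moreover have "rest a l + rest b l \<le> 1"
        using as l \<open>good a b\<close> by (simp add: good_def)
      ultimately show ?thesis
        by linarith
    qed
  qed simp
  then show ?thesis
    using desc by (simp add: normal_word_def)
qed

section \<open>Uniqueness of the normal word with a given length and sum\<close>

lemma normal_word_Cons:
  assumes "normal_word (a # as)"
  shows "normal_word as"
proof (cases "as = []")
  case False
  have "(\<Sum>a\<leftarrow>as. rest a l) \<le> (\<Sum>a\<leftarrow>a # as. rest a l)" for l
    by simp
  then show ?thesis
    using assms False unfolding normal_word_def
    by (auto simp del: list.map sum_list.Cons intro: order_trans)
qed (simp add: normal_word_def idx_def)

text \<open>In the Rees algebra presentation this is the exponent of the variable that belongs to
  the \<open>l\<close>-th square.\<close>

definition mult :: "(nat \<Rightarrow> nat) list \<Rightarrow> nat \<Rightarrow> nat" where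
  "mult as l = (\<Sum>a\<leftarrow>as. if idx a = l then 1 else 0)"

lemma sum_list_eq_rest_mult:
  "set as \<subseteq> gens n \<Longrightarrow> (\<Sum>a\<leftarrow>as. a l) = (\<Sum>a\<leftarrow>as. rest a l) + 2 * mult as l"
proof (induction as)
  case (Cons a as)
  then show ?case
    using rest_eq[of a n l] by (auto simp: mult_def)
qed (simp add: mult_def)

lemma sum_mult: "set as \<subseteq> gens n \<Longrightarrow> sum (mult as) {..<n} = length as"
proof (induction as)
  case (Cons a as)
  then show ?case
    using idx_less[of a n] by (simp add: mult_def sum.distrib)
qed (simp add: mult_def)

lemma mult_pos_iff: "0 < mult as l \<longleftrightarrow> (\<exists>a\<in>set as. idx a = l)"
  by (induction as) (auto simp: mult_def)

lemma descending_last: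
  "sorted_wrt descending as \<Longrightarrow> a \<in> set as \<Longrightarrow> idx a \<le> idx (last as)"
  by (induction as rule: rev_induct) (auto simp: sorted_wrt_append descending_def)

text \<open>Below the last index at most one letter \<open>l\<close> remains outside the squares, so
  parity determines the number of squares; above the last index there are none because the indices
  are sorted.\<close>

lemma normal_word_mult:
  assumes "set as \<subseteq> gens n" "normal_word as"
  shows "l < idx (last as) \<Longrightarrow> mult as l = (\<Sum>a\<leftarrow>as. a l) div 2"
    and "idx (last as) < l \<Longrightarrow> mult as l = 0"
proof -
  show "mult as l = (\<Sum>a\<leftarrow>as. a l) div 2" if "l < idx (last as)"
  proof -
    have "(\<Sum>a\<leftarrow>as. rest a l) \<le> 1"
      using that assms(2) by (simp add: normal_word_def)
    then show ?thesis
      using sum_list_eq_rest_mult[OF assms(1), of l] by linarith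
  qed
  show "mult as l = 0" if "idx (last as) < l"
    using mult_pos_iff[of as l] descending_last[of as] assms(2) that
    by (force simp: normal_word_def)
qed

text \<open>If the last index of \<open>as\<close> were smaller, \<open>mult as\<close> would be at
  most \<open>mult bs\<close> everywhere and smaller at the last index of \<open>bs\<close>,
  although both add up to the common length.\<close>

lemma normal_word_last_le:
  assumes "set as \<subseteq> gens n" "normal_word as" "set bs \<subseteq> gens n" "normal_word bs"
    and "length as = length bs" "as \<noteq> []" "\<And>l. (\<Sum>a\<leftarrow>as. a l) = (\<Sum>b\<leftarrow>bs. b l)"
  shows "idx (last bs) \<le> idx (last as)"
proof (rule ccontr)
  assume "\<not> ?thesis"
  then have less: "idx (last as) < idx (last bs)"
    by simp
  have "bs \<noteq> []"
    using assms(5,6) by auto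
  then have "idx (last bs) < n"
    using assms(3) idx_less last_in_set by blast
  have "mult as l \<le> mult bs l" for l
  proof (cases "l \<le> idx (last as)")
    case True
    then have "mult bs l = (\<Sum>a\<leftarrow>as. a l) div 2"
      using normal_word_mult(1)[OF assms(3,4)] less assms(7) by simp
    then show ?thesis
      using sum_list_eq_rest_mult[OF assms(1), of l] by simp
  next
    case False
    then show ?thesis
      using normal_word_mult(2)[OF assms(1,2)] by simp
  qed
  moreover have "mult as (idx (last bs)) < mult bs (idx (last bs))"
    using normal_word_mult(2)[OF assms(1,2) less] mult_pos_iff[of bs "idx (last bs)"] \<open>bs \<noteq> []\<close> by auto
  ultimately have "sum (mult as) {..<n} < sum (mult bs) {..<n}"
    using \<open>idx (last bs) < n\<close> by (intro sum_strict_mono_ex1) auto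
  then show False
    using sum_mult assms by simp
qed

text \<open>Away from the common last index the sum determines the multiplicities; the one value
  left is determined by the length.\<close>

lemma normal_word_mult_unique:
  assumes "set as \<subseteq> gens n" "normal_word as" "set bs \<subseteq> gens n" "normal_word bs"
    and "length as = length bs" "as \<noteq> []" "\<And>l. (\<Sum>a\<leftarrow>as. a l) = (\<Sum>b\<leftarrow>bs. b l)"
  shows "mult as = mult bs"
proof -
  define i where "i = idx (last as)"
  have "bs \<noteq> []"
    using assms(5,6) by auto
  have i: "i = idx (last bs)"
    unfolding i_def using normal_word_last_le[of as n bs] normal_word_last_le[of bs n as] assms \<open>bs \<noteq> []\<close>
    by (intro order_antisym) auto
  have "i < n"
    unfolding i_def using assms(1,6) idx_less last_in_set by blast
  have eq: "mult as l = mult bs l" if "l \<noteq> i" for l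
    using that normal_word_mult[OF assms(1,2), of l] normal_word_mult[OF assms(3,4), of l] assms(7)
    by (fold i_def i) (metis linorder_neqE_nat)
  have "mult as i + sum (mult as) ({..<n} - {i}) = mult bs i + sum (mult bs) ({..<n} - {i})"
    using sum_mult[OF assms(1)] sum_mult[OF assms(3)] assms(5) \<open>i < n\<close>
    by (simp flip: sum.remove)
  moreover have "sum (mult as) ({..<n} - {i}) = sum (mult bs) ({..<n} - {i})"
    by (intro sum.cong) (auto simp: eq)
  ultimately have "mult as i = mult bs i"
    by simp
  then have "mult as l = mult bs l" for l
    using eq by (cases "l = i") simp_all
  then show ?thesis
    by (rule ext)
qed

lemma sum_list_pos_exists:
  fixes f :: "'a \<Rightarrow> nat"
  assumes "0 < (\<Sum>x\<leftarrow>xs. f x)"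
  shows "\<exists>x\<in>set xs. 0 < f x"
  using assms by (induction xs) auto

text \<open>The first index is the least one with positive multiplicity, and the first block
  consists of the \<open>n - 2\<close> largest letters. Both depend only on the sum and the length,
  so the first vectors agree and induction applies.\<close>

lemma normal_word_unique:
  assumes "set as \<subseteq> gens n" "normal_word as" "set bs \<subseteq> gens n" "normal_word bs"
    and "length as = length bs" "\<And>l. (\<Sum>a\<leftarrow>as. a l) = (\<Sum>b\<leftarrow>bs. b l)"
  shows "as = bs"
  using assms
proof (induction as arbitrary: bs)
  case (Cons a as')
  then obtain b bs' where bs: "bs = b # bs'"
    by (cases bs) auto
  have mult: "mult (a # as') = mult (b # bs')"
    using normal_word_mult_unique[of "a # as'" n bs] Cons.prems bs by simp
  have idx: "idx a \<le> idx c" if "c \<in> set (a # as')" for c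
    using that Cons.prems(2) by (auto simp: normal_word_def descending_def)
  moreover have "idx b \<le> idx c" if "c \<in> set (b # bs')" for c
    using that Cons.prems(4) bs by (auto simp: normal_word_def descending_def)
  moreover have "\<exists>c\<in>set (a # as'). idx c = idx b" "\<exists>c\<in>set (b # bs'). idx c = idx a"
    using mult_pos_iff[of "a # as'" "idx b"] mult_pos_iff[of "b # bs'" "idx b"]
      mult_pos_iff[of "a # as'" "idx a"] mult_pos_iff[of "b # bs'" "idx a"] mult by auto
  ultimately have idx: "idx a = idx b"
    by (metis order_antisym)
  have ab: "a \<in> gens n" "b \<in> gens n"
    using Cons.prems bs by auto
  have restsum: "rest a l + (\<Sum>c\<leftarrow>as'. rest c l) = rest b l + (\<Sum>c\<leftarrow>bs'. rest c l)" for l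
    using sum_list_eq_rest_mult[OF Cons.prems(1), of l] sum_list_eq_rest_mult[OF Cons.prems(3), of l]
      Cons.prems(6)[of l] mult bs by simp
  have top: "l' \<le> l" if pos: "0 < rest a l" "0 < (\<Sum>c\<leftarrow>as'. rest c l')" for l l'
  proof -
    obtain c where "c \<in> set as'" "0 < rest c l'"
      using sum_list_pos_exists[OF pos(2)] by blast
    then show ?thesis
      using pos(1) Cons.prems(2) by (auto simp: normal_word_def descending_def)
  qed
  have top': "l' \<le> l" if pos: "0 < rest b l" "0 < (\<Sum>c\<leftarrow>bs'. rest c l')" for l l'
  proof -
    obtain c where "c \<in> set bs'" "0 < rest c l'"
      using sum_list_pos_exists[OF pos(2)] by blast
    then show ?thesis
      using pos(1) Cons.prems(4) bs by (auto simp: normal_word_def descending_def)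
  qed
  have sums: "sum (rest a) {..<n} = sum (rest b) {..<n}"
    using sum_rest[OF ab(1)] sum_rest[OF ab(2)] by simp
  have "rest a = rest b"
  proof (rule ccontr)
    assume "rest a \<noteq> rest b"
    then have ne: "\<exists>l<n. rest a l \<noteq> rest b l"
      using rest_outside ab by (metis ext not_less)
    have "\<exists>l<n. rest b l < rest a l"
    proof (rule ccontr)
      assume "\<not> ?thesis"
      then have "\<And>l. l < n \<Longrightarrow> rest a l \<le> rest b l"
        by (meson not_less)
      then show False
        using sum_mono_inv[OF sums] ne by auto
    qed
    moreover have "\<exists>l<n. rest a l < rest b l"
    proof (rule ccontr)
      assume "\<not> ?thesis"
      then have "\<And>l. l < n \<Longrightarrow> rest b l \<le> rest a l"
        by (meson not_less)
      then show False
        using sum_mono_inv[OF sums[symmetric]] ne by fastforce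
    qed
    \<comment> \<open>A letter that one first block has in excess must occur in the tail of the
      other word, hence is at most every letter of the other first block. Applied both ways, this
      gives \<open>l = l'\<close>.\<close>
    ultimately obtain l l' where ll: "rest b l < rest a l" "rest a l' < rest b l'"
      by blast
    have "l' \<le> l"
      using top[of l l'] restsum[of l'] ll by linarith
    moreover have "l \<le> l'"
      using top'[of l' l] restsum[of l] ll by linarith
    ultimately show False
      using ll by simp
  qed
  then have "a = b"
    using rest_eq[OF ab(1)] rest_eq[OF ab(2)] idx by (intro ext) simp
  moreover have "as' = bs'"
    using Cons.prems bs \<open>a = b\<close> by (intro Cons.IH) (auto intro: normal_word_Cons)
  ultimately show ?case
    using bs by simp
qed simp


subsection \<open>Saturated sequences\<close>

text \<open>Chains indexed by rank. The fixed value beyond \<open>k\<close> makes the function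
  unique for its chain.\<close>

definition saturated :: "nat \<Rightarrow> nat \<Rightarrow> (nat \<Rightarrow> nat) \<Rightarrow> (nat \<Rightarrow> nat \<Rightarrow> nat) set" where
  "saturated n k z = {x. x 0 = 0 \<and> (\<forall>r\<ge>k. x r = z) \<and>
     (\<forall>r<k. x r \<le> x (Suc r) \<and> x (Suc r) - x r \<in> gens n)}"

definition step :: "(nat \<Rightarrow> nat \<Rightarrow> nat) \<Rightarrow> nat \<Rightarrow> nat \<Rightarrow> nat" where
  "step x r = x (Suc r) - x r"

text \<open>
  Lexicographic: the first component decreases when an index drops or two indices get sorted, the
  second one when letters are exchanged between blocks without changing the indices.
\<close>

definition key :: "nat \<Rightarrow> nat \<Rightarrow> (nat \<Rightarrow> nat \<Rightarrow> nat) \<Rightarrow> nat \<times> int" where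
  "key n k x = (\<Sum>r<k. (k - r) * idx (step x r), - (\<Sum>r\<le>k. int (wt n (x r))))"

lemma saturated_ends: "x \<in> saturated n k z \<Longrightarrow> x 0 = 0" "x \<in> saturated n k z \<Longrightarrow> k \<le> r \<Longrightarrow> x r = z"
  by (simp_all add: saturated_def)

lemma saturated_step:
  assumes "x \<in> saturated n k z" "r < k"
  shows "x (Suc r) = x r + step x r" "step x r \<in> gens n"
  using assms by (auto simp: saturated_def step_def fun_eq_iff le_fun_def)

lemma saturated_mono: "x \<in> saturated n k z \<Longrightarrow> r \<le> s \<Longrightarrow> x r \<le> x s"
  by (rule lift_Suc_mono_le) (metis (mono_tags, lifting) saturated_def mem_Collect_eq
      not_le le_SucI order_refl)

lemma saturated_nat_vectors: "x \<in> saturated n k z \<Longrightarrow> r \<le> k \<Longrightarrow> x r \<in> nat_vectors n"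
proof (induction r)
  case 0
  then show ?case
    by (simp add: saturated_def nat_vectors_def)
next
  case (Suc r)
  then show ?case
    using saturated_step[of x n k z r] by (simp add: nat_vectors_def gens_def)
qed

lemma saturated_sum: "x \<in> saturated n k z \<Longrightarrow> r \<le> k \<Longrightarrow> sum (x r) {..<n} = r * n"
proof (induction r)
  case 0
  then show ?case
    by (simp add: saturated_def)
next
  case (Suc r)
  then show ?case
    using saturated_step[of x n k z r] by (simp add: sum.distrib gens_def)
qed

lemma wt_add: "wt n (a + b) = wt n a + wt n b"
  by (simp add: wt_def sum.distrib algebra_simps)

lemma sum_split_two:
  fixes f :: "nat \<Rightarrow> nat"
  assumes "Suc r < k"
  shows "(\<Sum>s<k. f s) = f r + f (Suc r) + (\<Sum>s\<in>{..<k} - {r} - {Suc r}. f s)"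
  using assms by (simp add: sum.remove[of "{..<k}" r] sum.remove[of "{..<k} - {r}" "Suc r"])

text \<open>Transfers the exchange of two adjacent steps to the chain, where it replaces the single
  element of rank \<open>Suc r\<close>.\<close>

lemma saturated_improves:
  assumes x: "x \<in> saturated n k z" and r: "Suc r < k" and bad: "\<not> good (step x r) (step x (Suc r))"
  shows "\<exists>w. x(Suc r := w) \<in> saturated n k z \<and> key n k (x(Suc r := w)) < key n k x"
proof -
  let ?a = "step x r" and ?b = "step x (Suc r)"
  have ab: "?a \<in> gens n" "?b \<in> gens n"
    using saturated_step[OF x] r by auto
  have xr: "x (Suc r) = x r + ?a" and xr2: "x (Suc (Suc r)) = x r + (?a + ?b)"
    using saturated_step(1)[OF x, of r] saturated_step(1)[OF x, of "Suc r"] r by (auto simp: add.assoc)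
  obtain a b where ab': "a \<in> gens n" "b \<in> gens n" and sum: "a + b = ?a + ?b"
    and cases: "idx a \<le> idx ?a \<and> idx b < idx ?b \<or>
     idx a = idx ?b \<and> idx b = idx ?a \<and> idx ?b < idx ?a \<or>
     idx a \<le> idx ?a \<and> idx b \<le> idx ?b \<and> wt n ?a < wt n a"
    using bad_pair_improves[OF ab bad] by blast
  \<comment> \<open>Since \<open>a + b\<close> is the sum of the two old steps, all later elements
    can stay in place.\<close>
  define y where "y = x(Suc r := x r + a)"
  have y: "y (Suc r) = x r + a" "y r = x r" "y (Suc (Suc r)) = x r + a + b" "\<And>s. s \<noteq> Suc r \<Longrightarrow> y s = x s"
    using xr2 sum by (auto simp: y_def add.assoc)
  have step_y: "step y r = a" "step y (Suc r) = b"
    unfolding step_def y by (auto simp: fun_eq_iff)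
  have step_y': "step y s = step x s" if "s \<noteq> r" "s \<noteq> Suc r" for s
    using that by (simp add: step_def y_def)
  have "y s \<le> y (Suc s) \<and> step y s \<in> gens n" if "s < k" for s
  proof -
    consider "s = r" | "s = Suc r" | "s \<noteq> r" "s \<noteq> Suc r"
      by blast
    then show ?thesis
    proof cases
      case 1
      then show ?thesis
        using ab' step_y y by (simp add: le_fun_def)
    next
      case 2
      then show ?thesis
        using ab' step_y y by (simp add: le_fun_def)
    next
      case 3
      then show ?thesis
        using saturated_step(2)[OF x that] saturated_mono[OF x, of s "Suc s"] step_y'[OF 3] y(4)[of s] y(4)[of "Suc s"]
        by simp
    qed
  qed
  moreover have "y 0 = 0" "\<forall>s\<ge>k. y s = z"
    using x r by (auto simp: y_def saturated_def)
  ultimately have "y \<in> saturated n k z"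
    by (simp add: saturated_def step_def)
  let ?R = "\<Sum>s\<in>{..<k} - {r} - {Suc r}. (k - s) * idx (step x s)"
  \<comment> \<open>The two changed steps have weights \<open>Suc c\<close> and \<open>c\<close> in
    the first component. As \<open>c\<close> is positive, a drop of the second index counts; as the
    first weight is larger, sorting two indices counts.\<close>
  define c where "c = k - Suc r"
  have c: "0 < c" "k - r = Suc c"
    using r by (auto simp: c_def)
  have fst_x: "fst (key n k x) = Suc c * idx ?a + c * idx ?b + ?R"
    using sum_split_two[OF r, of "\<lambda>s. (k - s) * idx (step x s)"] c by (simp add: key_def c_def)
  have "(\<Sum>s\<in>{..<k} - {r} - {Suc r}. (k - s) * idx (step y s)) = ?R"
    by (intro sum.cong) (auto simp: step_y')
  then have fst_y: "fst (key n k y) = Suc c * idx a + c * idx b + ?R"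
    using sum_split_two[OF r, of "\<lambda>s. (k - s) * idx (step y s)"] c step_y by (simp add: key_def c_def)
  have weight: "snd (key n k y) < snd (key n k x)" if "wt n ?a < wt n a"
  proof -
    have "(\<Sum>s\<le>k. int (wt n (x s))) < (\<Sum>s\<le>k. int (wt n (y s)))"
    proof (rule sum_strict_mono_ex1)
      show "\<forall>s\<in>{..k}. int (wt n (x s)) \<le> int (wt n (y s))"
      proof
        fix s
        show "int (wt n (x s)) \<le> int (wt n (y s))"
          using that xr y(1) y(4)[of s] by (cases "s = Suc r") (simp_all add: wt_add)
      qed
      show "\<exists>s\<in>{..k}. int (wt n (x s)) < int (wt n (y s))"
        using that xr y(1) r by (intro bexI[of _ "Suc r"]) (simp_all add: wt_add)
    qed simp
    then show ?thesis
      by (simp add: key_def)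
  qed
  have "key n k y < key n k x"
    using cases
  proof (elim disjE conjE)
    assume "idx a \<le> idx ?a" "idx b < idx ?b"
    then have "Suc c * idx a \<le> Suc c * idx ?a" "c * idx b < c * idx ?b"
      using c by (blast intro: mult_le_mono2, simp)
    then have "fst (key n k y) < fst (key n k x)"
      unfolding fst_x fst_y by linarith
    then show ?thesis
      by (simp add: less_prod_def)
  next
    assume "idx a = idx ?b" "idx b = idx ?a" "idx ?b < idx ?a"
    then show ?thesis
      using fst_x fst_y by (simp add: less_prod_def)
  next
    assume "idx a \<le> idx ?a" "idx b \<le> idx ?b" "wt n ?a < wt n a"
    moreover from this have "Suc c * idx a \<le> Suc c * idx ?a" "c * idx b \<le> c * idx ?b"
      by (blast intro: mult_le_mono2)+
    ultimately have "fst (key n k y) \<le> fst (key n k x)" "snd (key n k y) < snd (key n k x)"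
      unfolding fst_x fst_y using weight by (linarith, blast)
    then show ?thesis
      by (auto simp: less_prod_def)
  qed
  then show ?thesis
    using \<open>y \<in> saturated n k z\<close> y_def by blast
qed

section \<open>Chains that are normal between pinned ranks\<close>

lemma sum_list_steps:
  assumes "x \<in> saturated n k z" "p \<le> q" "q \<le> k"
  shows "x p l + (\<Sum>a\<leftarrow>map (step x) [p..<q]. a l) = x q l"
  using assms(2,3)
proof (induction q rule: dec_induct)
  case (step q)
  then show ?case
    using saturated_step(1)[OF assms(1), of q] by simp
qed simp

text \<open>\<open>Y\<close> is meant as the set of pinned ranks, at which the chain may not be
  changed; \<open>Suc r\<close> is the rank between the two steps compared.\<close>

definition normal_off :: "nat set \<Rightarrow> nat \<Rightarrow> (nat \<Rightarrow> nat \<Rightarrow> nat) \<Rightarrow> bool" where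
  "normal_off Y k x \<longleftrightarrow> (\<forall>r. Suc r < k \<longrightarrow> Suc r \<notin> Y \<longrightarrow> good (step x r) (step x (Suc r)))"

lemma normal_word_steps:
  assumes "4 \<le> n" "x \<in> saturated n k z" "p \<le> q" "q \<le> k"
    and "\<And>r. p < r \<Longrightarrow> r < q \<Longrightarrow> r \<notin> Y" "normal_off Y k x"
  shows "normal_word (map (step x) [p..<q])"
proof (rule normal_wordI[OF assms(1)])
  show "set (map (step x) [p..<q]) \<subseteq> gens n"
    using saturated_step(2)[OF assms(2)] assms(4) by auto
  show "successively good (map (step x) [p..<q])"
    unfolding successively_conv_nth using assms by (auto simp: normal_off_def)
qed

text \<open>Between neighbouring pinned ranks both chains spell normal words of equal length and
  equal sum, so uniqueness of normal words applies.\<close>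

lemma normal_off_unique:
  assumes n: "4 \<le> n" and x: "x \<in> saturated n k z" and y: "y \<in> saturated n k z"
    and Y: "0 \<in> Y" "k \<in> Y" and agree: "\<And>r. r \<in> Y \<Longrightarrow> x r = y r"
    and normal: "normal_off Y k x" "normal_off Y k y"
  shows "x = y"
proof
  fix r
  show "x r = y r"
  proof (cases "r \<le> k")
    case True
    \<comment> \<open>The nearest pinned ranks around \<open>r\<close> exist because 0 and
      \<open>k\<close> are pinned. For \<open>r\<close> in \<open>Y\<close> both equal
      \<open>r\<close> and the words are empty.\<close>
    define p where "p = Max {p \<in> Y. p \<le> r}"
    define q where "q = (LEAST q. q \<in> Y \<and> r \<le> q)"
    have "p \<in> {p \<in> Y. p \<le> r}"
      unfolding p_def using Y by (intro Max_in) auto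
    then have p: "p \<in> Y" "p \<le> r"
      by auto
    have q: "q \<in> Y" "r \<le> q"
      unfolding q_def by (rule LeastI2[of _ k]; use Y True in auto)+
    have "q \<le> k"
      unfolding q_def using Y True by (intro Least_le) auto
    have gap: "s \<notin> Y" if "p < s" "s < q" for s
    proof
      assume "s \<in> Y"
      show False
      proof (cases "s \<le> r")
        case True
        then have "s \<le> p"
          unfolding p_def using \<open>s \<in> Y\<close> by (intro Max_ge) auto
        then show False
          using that by simp
      next
        case False
        then have "q \<le> s"
          unfolding q_def using \<open>s \<in> Y\<close> by (intro Least_le) auto
        then show False
          using that by simp
      qed
    qed
    have "map (step x) [p..<q] = map (step y) [p..<q]"
    proof (rule normal_word_unique)
      show "set (map (step x) [p..<q]) \<subseteq> gens n" "set (map (step y) [p..<q]) \<subseteq> gens n"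
        using saturated_step(2)[OF x] saturated_step(2)[OF y] \<open>q \<le> k\<close> by auto
      show "normal_word (map (step x) [p..<q])" "normal_word (map (step y) [p..<q])"
        using normal_word_steps[OF n x _ \<open>q \<le> k\<close> gap normal(1)]
          normal_word_steps[OF n y _ \<open>q \<le> k\<close> gap normal(2)] p q by auto
      show "(\<Sum>a\<leftarrow>map (step x) [p..<q]. a l) = (\<Sum>a\<leftarrow>map (step y) [p..<q]. a l)" for l
        using sum_list_steps[OF x _ \<open>q \<le> k\<close>, of p l] sum_list_steps[OF y _ \<open>q \<le> k\<close>, of p l]
          agree[OF p(1)] agree[OF q(1)] p(2) q(2) by simp
    qed simp
    then have steps: "step x s = step y s" if "p \<le> s" "s < q" for s
      using that by simp
    have "x p l + (\<Sum>a\<leftarrow>map (step x) [p..<r]. a l) = y p l + (\<Sum>a\<leftarrow>map (step y) [p..<r]. a l)" for l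
      using agree[OF p(1)] steps q(2) by (auto intro!: arg_cong[of _ _ sum_list])
    then show ?thesis
      using sum_list_steps[OF x p(2) True] sum_list_steps[OF y p(2) True] by (intro ext) simp
  next
    case False
    then show ?thesis
      using x y by (simp add: saturated_def)
  qed
qed

text \<open>Ties of the key are broken by an arbitrary numbering. An earlier chain therefore has
  only a weakly smaller key, whereas the exchanged chain needs a strictly smaller one.\<close>

lemma ex_shelling_order:
  fixes key :: "'a set \<Rightarrow> 'b::linorder"
  assumes fin: "finite (maximal_chains r)"
    and exchange: "\<And>c c'. c \<in> maximal_chains r \<Longrightarrow> c' \<in> maximal_chains r \<Longrightarrow> c \<noteq> c' \<Longrightarrow> key c' \<le> key c \<Longrightarrow>
      \<exists>d\<in>maximal_chains r. key d < key c \<and> c \<inter> c' \<subseteq> d \<and> card (sym_diff c d) = 2"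
  shows "\<exists>L. shelling_order r L"
proof -
  obtain num :: "'a set \<Rightarrow> nat" where num: "inj_on num (maximal_chains r)"
    using finite_imp_inj_to_nat_seg[OF fin] by blast
  define L where "L = {(c, d). c \<in> maximal_chains r \<and> d \<in> maximal_chains r \<and> (key c, num c) \<le> (key d, num d)}"
  have "linear_order_on (maximal_chains r) L"
    unfolding linear_order_on_def partial_order_on_def preorder_on_def refl_on_def total_on_def
  proof (intro conjI)
    show "trans L"
      by (rule transI) (auto simp: L_def)
    show "antisym L"
      using num by (intro antisymI) (auto simp: L_def inj_on_def)
  qed (auto simp: L_def)
  moreover have "(d, c) \<in> L \<and> d \<noteq> c" if "d \<in> maximal_chains r" "c \<in> maximal_chains r" "key d < key c" for c d
    using that by (auto simp: L_def)
  moreover have "key c' \<le> key c" if "(c', c) \<in> L" for c c'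
    using that by (auto simp: L_def)
  ultimately show ?thesis
    unfolding shelling_order_def by (intro exI[of _ L]) (metis exchange Int_greatest Int_lower1)
qed


subsection \<open>Intervals of the pinched Veronese poset\<close>

lemma ex_le_sum:
  fixes w :: "nat \<Rightarrow> nat"
  assumes "m \<le> sum w {..<n}"
  shows "\<exists>g\<in>nat_vectors n. g \<le> w \<and> sum g {..<n} = m"
  using assms
proof (induction m)
  case 0
  then show ?case
    by (intro bexI[of _ 0]) (auto simp: nat_vectors_def le_fun_def)
next
  case (Suc m)
  then obtain g where g: "g \<in> nat_vectors n" "g \<le> w" "sum g {..<n} = m"
    by auto
  have "\<exists>i<n. g i < w i"
  proof (rule ccontr)
    assume "\<not> ?thesis"
    then have "sum w {..<n} \<le> sum g {..<n}"
      by (intro sum_mono) (meson lessThan_iff not_less)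
    then show False
      using g Suc.prems by simp
  qed
  then obtain i where i: "i < n" "g i < w i"
    by blast
  have "sum (g(i := g i + 1)) {..<n} = Suc m"
    using i g(3) by (simp add: sum.remove[of "{..<n}" i])
  moreover have "g(i := g i + 1) \<le> w" "g(i := g i + 1) \<in> nat_vectors n"
    using g i by (auto simp: le_fun_def nat_vectors_def)
  ultimately show ?case
    by blast
qed

text \<open>Used for gradedness: it refines a chain between comparable elements whose degrees differ
  by at least two, while avoiding the all-ones vector on both sides.\<close>

lemma gens_split:
  assumes n: "4 \<le> n" and w: "w \<in> nat_vectors n" and sum_w: "2 * n \<le> sum w {..<n}"
  shows "\<exists>g\<in>gens n. g \<le> w \<and> w - g \<noteq> all_ones n"
proof -
  obtain g where g: "g \<in> nat_vectors n" "g \<le> w" "sum g {..<n} = n"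
    using ex_le_sum[of n w n] sum_w by auto
  show ?thesis
  proof (cases "g = all_ones n \<or> w - g = all_ones n")
    case False
    then show ?thesis
      using g by (auto simp: gens_def)
  next
    case True
    \<comment> \<open>Now \<open>w\<close> dominates the all-ones vector, and two perturbations of that vector are candidates.\<close>
    have one_le: "1 \<le> w i" if "i < n" for i
      using True g(2) that by (auto simp: le_fun_def all_ones_def fun_eq_iff dest: spec[of _ i])
    have "\<exists>t<n. 2 \<le> w t"
    proof (rule ccontr)
      assume "\<not> ?thesis"
      then have "sum w {..<n} \<le> (\<Sum>i<n. 1)"
        by (intro sum_mono) (auto simp: not_le)
      then show False
        using sum_w n by simp
    qed
    then obtain t where t: "t < n" "2 \<le> w t"
      by blast
    obtain p q where pq: "p < n" "q < n" "p \<noteq> t" "q \<noteq> t" "p \<noteq> q"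
    proof -
      consider "t = 0" | "t = 1" | "2 \<le> t"
        by linarith
      then show thesis
        using n that[of 1 2] that[of 0 2] that[of 0 1] by cases auto
    qed
    have moved: "move s t 1 (all_ones n) \<in> gens n \<and> move s t 1 (all_ones n) \<le> w" if "s < n" "s \<noteq> t" for s
    proof
      have "2 \<le> move s t 1 (all_ones n) t"
        using t by (simp add: move_def all_ones_def)
      moreover have "move s t 1 (all_ones n) \<in> nat_vectors n"
        using that t by (simp add: move_def all_ones_def nat_vectors_def)
      moreover have "sum (move s t 1 (all_ones n)) {..<n} = n"
        using sum_move[of s t n 1 "all_ones n" "\<lambda>_. 1"] that t by (simp add: all_ones_def)
      ultimately show "move s t 1 (all_ones n) \<in> gens n"
        by (intro gensI)
      show "move s t 1 (all_ones n) \<le> w"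
        using one_le t that by (auto simp: move_def all_ones_def le_fun_def)
    qed
    \<comment> \<open>The two candidates have the values 0 and 1 at \<open>p\<close>, so they cannot
      both leave the remainder 1 there.\<close>
    have "w - move p t 1 (all_ones n) \<noteq> all_ones n \<or> w - move q t 1 (all_ones n) \<noteq> all_ones n"
    proof (rule ccontr)
      assume "\<not> ?thesis"
      then have "w p - move p t 1 (all_ones n) p = 1" "w p - move q t 1 (all_ones n) p = 1"
        using pq by (metis all_ones_def minus_apply)+
      then show False
        using pq by (simp add: move_def all_ones_def)
    qed
    then show ?thesis
      using moved pq by blast
  qed
qed

section \<open>The order relation and its intervals\<close>

lemma pinched_veronese_order_iff:
  "(a, b) \<in> pinched_veronese_order n \<longleftrightarrow>
    a \<in> pinched_veronese n \<and> b \<in> pinched_veronese n \<and> a \<le> b \<and> b - a \<noteq> all_ones n"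
  by (auto simp: pinched_veronese_order_def relation_of_def)

text \<open>If \<open>c - a\<close> were all ones, the coordinate sum of \<open>b\<close>, a
  multiple of \<open>n\<close>, would equal that of \<open>a\<close> or \<open>c\<close>. Then
  \<open>b\<close> is one of them, and the other difference is all ones.\<close>

lemma pinched_veronese_order_trans:
  assumes "0 < n" "(a, b) \<in> pinched_veronese_order n" "(b, c) \<in> pinched_veronese_order n"
  shows "(a, c) \<in> pinched_veronese_order n"
proof -
  have V: "a \<in> pinched_veronese n" "b \<in> pinched_veronese n" "c \<in> pinched_veronese n"
    and le: "a \<le> b" "b \<le> c" and ne: "b - a \<noteq> all_ones n" "c - b \<noteq> all_ones n"
    using assms by (auto simp: pinched_veronese_order_iff)
  have "c - a \<noteq> all_ones n"
  proof
    assume ca: "c - a = all_ones n"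
    have dvd: "n dvd sum a {..<n}" "n dvd sum b {..<n}" "n dvd sum c {..<n}"
      using V by (auto simp: pinched_veronese_def)
    have sums: "sum a {..<n} \<le> sum b {..<n}" "sum b {..<n} \<le> sum c {..<n}"
      using le by (auto intro!: sum_mono simp: le_fun_def)
    have "sum c {..<n} - sum a {..<n} = sum (c - a) {..<n}"
      using le by (auto simp: le_fun_def intro!: sum_subtractf_nat[symmetric] intro: order_trans)
    then have eq: "sum c {..<n} = sum a {..<n} + n"
      using ca sums by simp
    have "sum b {..<n} = sum a {..<n} \<or> sum c {..<n} = sum b {..<n}"
    proof (rule ccontr)
      assume "\<not> ?thesis"
      then have "sum b {..<n} - sum a {..<n} < n" "0 < sum b {..<n} - sum a {..<n}"
        using eq sums by linarith+
      moreover have "n dvd sum b {..<n} - sum a {..<n}"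
        using dvd by simp
      ultimately show False
        using nat_dvd_not_less by blast
    qed
    then have "a = b \<or> b = c"
      using vector_eqI[OF _ _ le(1), of n] vector_eqI[OF _ _ le(2), of n] V
      unfolding pinched_veronese_def mem_Collect_eq by metis
    then show False
      using ca ne by auto
  qed
  then show ?thesis
    using V le by (auto simp: pinched_veronese_order_iff)
qed

locale pinched_interval =
  fixes n k :: nat and z :: "nat \<Rightarrow> nat"
  assumes n: "4 \<le> n" and z: "z \<in> pinched_veronese n" and sum_z: "sum z {..<n} = k * n"
begin

definition I where "I = order_interval (pinched_veronese_order n) 0 z"

definition R where "R = Restr (pinched_veronese_order n) I"

lemma zero_mem: "0 \<in> pinched_veronese n"
proof -
  have "0 \<noteq> all_ones n"
    using n by (auto simp: all_ones_def fun_eq_iff intro!: exI[of _ 0])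
  then show ?thesis
    by (simp add: pinched_veronese_def nat_vectors_def)
qed

lemma I_iff: "w \<in> I \<longleftrightarrow> w \<in> pinched_veronese n \<and> w \<le> z \<and> z - w \<noteq> all_ones n"
  using zero_mem z
  by (auto simp: I_def order_interval_def pinched_veronese_order_iff le_fun_def)
     (auto simp: pinched_veronese_def fun_diff_def)

lemma R_iff: "(a, b) \<in> R \<longleftrightarrow> a \<in> I \<and> b \<in> I \<and> a \<le> b \<and> b - a \<noteq> all_ones n"
  by (auto simp: R_def pinched_veronese_order_iff I_iff)

lemma I_sum: "w \<in> I \<Longrightarrow> \<exists>r\<le>k. sum w {..<n} = r * n"
proof -
  assume w: "w \<in> I"
  then obtain r where r: "sum w {..<n} = r * n"
    by (auto simp: I_iff pinched_veronese_def elim!: dvdE) (metis mult.commute)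
  moreover have "sum w {..<n} \<le> sum z {..<n}"
    using w by (auto simp: I_iff le_fun_def intro: sum_mono)
  ultimately show ?thesis
    using sum_z n by auto
qed

lemma R_trans: "(a, b) \<in> R \<Longrightarrow> (b, c) \<in> R \<Longrightarrow> (a, c) \<in> R"
  using pinched_veronese_order_trans[of n a b c] n by (auto simp: R_def)

lemma R_refl: "a \<in> I \<Longrightarrow> (a, a) \<in> R"
  using zero_mem by (auto simp: R_iff pinched_veronese_def fun_eq_iff)

lemma zero_I: "0 \<in> I"
  using zero_mem z by (auto simp: I_iff le_fun_def) (auto simp: pinched_veronese_def fun_diff_def)

lemma top_I: "z \<in> I"
  using zero_mem z by (auto simp: I_iff) (auto simp: pinched_veronese_def fun_diff_def fun_eq_iff)

lemma zero_R: "w \<in> I \<Longrightarrow> (0, w) \<in> R"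
  using zero_I by (auto simp: R_iff I_iff le_fun_def) (auto simp: pinched_veronese_def fun_diff_def)

lemma R_top: "w \<in> I \<Longrightarrow> (w, z) \<in> R"
  using top_I by (auto simp: R_iff I_iff)

lemma partial_order_R: "partial_order_on I R"
  unfolding partial_order_on_def preorder_on_def refl_on_def
proof (intro conjI)
  show "R \<subseteq> I \<times> I"
    by (auto simp: R_def)
  show "\<forall>a\<in>I. (a, a) \<in> R"
    using R_refl by blast
  show "trans R"
    using R_trans by (rule transI)
  show "antisym R"
    by (rule antisymI) (metis R_iff order_antisym)
qed

lemma R_sum_eq:
  assumes "(a, b) \<in> R \<or> (b, a) \<in> R" "sum a {..<n} = sum b {..<n}"
  shows "a = b"
  using assms vector_eqI[of a n b] vector_eqI[of b n a]
  by (auto simp: R_iff I_iff pinched_veronese_def)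

lemma R_sum_le: "(a, b) \<in> R \<Longrightarrow> sum a {..<n} \<le> sum b {..<n}"
  by (auto simp: R_iff le_fun_def intro: sum_mono)

lemma finite_I: "finite I"
proof -
  have "I \<subseteq> {f. \<forall>i. (i \<in> {..<n} \<longrightarrow> f i \<in> {..Max (z ` {..<n})}) \<and> (i \<notin> {..<n} \<longrightarrow> f i = 0)}"
    by (auto simp: I_iff pinched_veronese_def nat_vectors_def le_fun_def)
       (meson Max_ge finite_imageI finite_lessThan imageI lessThan_iff order_trans)
  then show ?thesis
    by (rule finite_subset) (intro finite_set_of_finite_funs; simp)
qed

section \<open>Maximal chains correspond to saturated sequences\<close>

lemma saturated_diff:
  assumes x: "x \<in> saturated n k z" and "r \<le> s" "s \<le> k"
  shows "x s - x r \<noteq> all_ones n"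
proof
  assume eq: "x s - x r = all_ones n"
  have "sum (x s - x r) {..<n} = s * n - r * n"
    using saturated_mono[OF x \<open>r \<le> s\<close>] saturated_sum[OF x, of r] saturated_sum[OF x, of s] assms
    by (simp add: le_fun_def sum_subtractf_nat)
  then have "(s - r) * n = 1 * n"
    using eq by (simp add: diff_mult_distrib)
  \<comment> \<open>By degree the difference is a single step, and \<open>gens n\<close> excludes
    the all-ones vector.\<close>
  then have "s = Suc r"
    using n assms(2) by auto
  then show False
    using saturated_step(2)[OF x, of r] assms(3) eq by (simp add: step_def gens_def)
qed

lemma saturated_R:
  assumes x: "x \<in> saturated n k z" and "r \<le> s" "s \<le> k"
  shows "(x r, x s) \<in> R"
proof -
  have "x r \<in> I" if "r \<le> k" for r
  proof -
    have "x r \<noteq> all_ones n"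
      using saturated_diff[OF x, of 0 r] x that by (simp add: saturated_def fun_diff_def)
    moreover have "x k = z"
      using x by (simp add: saturated_def)
    ultimately show ?thesis
      using saturated_diff[OF x that] saturated_sum[OF x that] saturated_nat_vectors[OF x that]
        saturated_mono[OF x that] by (simp add: I_iff pinched_veronese_def)
  qed
  then show ?thesis
    using saturated_diff[OF assms] saturated_mono[OF x \<open>r \<le> s\<close>] assms by (auto simp: R_iff)
qed

lemma saturated_eq_rank:
  assumes "x \<in> saturated n k z" "y \<in> saturated n k z" "x r = y s" "r \<le> k" "s \<le> k"
  shows "r = s"
  using saturated_sum[OF assms(1), of r] saturated_sum[OF assms(2), of s] assms n by simp

lemma saturated_maximal:
  assumes x: "x \<in> saturated n k z"
  shows "x ` {..k} \<in> maximal_chains R"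
  unfolding maximal_chains_def
proof (intro CollectI conjI ballI impI)
  show "x ` {..k} \<in> Chains R"
    unfolding Chains_def
  proof (intro CollectI ballI)
    fix a b assume "a \<in> x ` {..k}" "b \<in> x ` {..k}"
    then obtain r s where "a = x r" "b = x s" "r \<le> k" "s \<le> k"
      by auto
    then show "(a, b) \<in> R \<or> (b, a) \<in> R"
      using saturated_R[OF x, of r s] saturated_R[OF x, of s r] by (cases "r \<le> s") auto
  qed
  fix D assume D: "D \<in> Chains R" "x ` {..k} \<subseteq> D"
  \<comment> \<open>Comparable elements of equal degree coincide, and \<open>x\<close> already has
    an element of every rank.\<close>
  have "w \<in> x ` {..k}" if w: "w \<in> D" for w
  proof -
    have "w \<in> I"
      using D w by (auto simp: Chains_def R_iff)
    then obtain r where r: "r \<le> k" "sum w {..<n} = r * n"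
      using I_sum by blast
    then have "(w, x r) \<in> R \<or> (x r, w) \<in> R"
      using D w by (auto simp: Chains_def)
    then have "w = x r"
      using R_sum_eq r saturated_sum[OF x, of r] by simp
    then show ?thesis
      using r by simp
  qed
  then show "D = x ` {..k}"
    using D by blast
qed

lemma maximal_chain_insert:
  assumes "C \<in> maximal_chains R" "w \<in> I" "\<And>c. c \<in> C \<Longrightarrow> (c, w) \<in> R \<or> (w, c) \<in> R"
  shows "w \<in> C"
proof -
  have "insert w C \<in> Chains R"
    using assms R_refl[of w] unfolding maximal_chains_def Chains_def by blast
  then show ?thesis
    using assms(1) unfolding maximal_chains_def by blast
qed

text \<open>No rank is skipped: a gap above an element of rank \<open>r\<close> could be filled by
  \<open>gens_split\<close>, against maximality.\<close>

lemma maximal_chain_rank: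
  assumes C: "C \<in> maximal_chains R"
  shows "r \<le> k \<Longrightarrow> \<exists>w\<in>C. sum w {..<n} = r * n"
proof (induction r)
  have comparable: "(a, b) \<in> R \<or> (b, a) \<in> R" if "a \<in> C" "b \<in> C" for a b
    using C that by (auto simp: maximal_chains_def Chains_def)
  then have CI: "C \<subseteq> I"
    using R_iff by blast
  then have "finite C"
    using finite_I finite_subset by blast
  {
    case 0
    have "0 \<in> C"
      using CI zero_R zero_I by (intro maximal_chain_insert[OF C]) blast+
    then show ?case
      by (intro bexI[of _ 0]) auto
  next
    case (Suc r)
    then obtain p where p: "p \<in> C" "sum p {..<n} = r * n"
      by auto
    show ?case
    proof (rule ccontr)
      assume missing: "\<not> ?case"
      define B where "B = {w \<in> C. r * n < sum w {..<n}}"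
      have "z \<in> C"
        using CI R_top top_I by (intro maximal_chain_insert[OF C]) blast+
      then have "z \<in> B"
        using sum_z Suc.prems n by (simp add: B_def)
      moreover have "finite B"
        using \<open>finite C\<close> by (simp add: B_def)
      \<comment> \<open>\<open>q\<close> is the next chain element above \<open>p\<close>; as rank
        \<open>Suc r\<close> is missing, the degree jumps by at least two.\<close>
      ultimately obtain q where q: "q \<in> B" "\<And>w. w \<in> B \<Longrightarrow> sum q {..<n} \<le> sum w {..<n}"
        using arg_min_if_finite(1)[of B "\<lambda>w. sum w {..<n}"] arg_min_least[of B _ "\<lambda>w. sum w {..<n}"]
        by blast
      have "q \<in> C"
        using q(1) by (simp add: B_def)
      obtain t where t: "sum q {..<n} = t * n"
        using I_sum CI \<open>q \<in> C\<close> by blast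
      have "r < t" "t \<noteq> Suc r"
        using q(1) t missing \<open>q \<in> C\<close> by (auto simp: B_def)
      then have "Suc (Suc r) \<le> t"
        by simp
      then have tn: "r * n + 2 * n \<le> t * n"
        using mult_le_mono1[of "Suc (Suc r)" t n] by simp
      then have "\<not> sum q {..<n} \<le> sum p {..<n}"
        using p(2) t n by linarith
      then have pq: "(p, q) \<in> R"
        using comparable[OF p(1) \<open>q \<in> C\<close>] R_sum_le[of q p] by blast
      then have pq': "p \<in> I" "q \<in> I" "p \<le> q"
        by (auto simp: R_iff)
      have V: "p \<in> nat_vectors n" "q \<in> nat_vectors n" "q \<le> z"
        using pq' by (auto simp: I_iff pinched_veronese_def)
      have "sum (q - p) {..<n} = t * n - r * n"
        using pq' p t by (simp add: le_fun_def sum_subtractf_nat)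
      then have "2 * n \<le> sum (q - p) {..<n}"
        using tn by simp
      moreover have "q - p \<in> nat_vectors n"
        using V by (simp add: nat_vectors_def)
      ultimately obtain g where g: "g \<in> gens n" "g \<le> q - p" "q - p - g \<noteq> all_ones n"
        using gens_split[OF n] by blast
      let ?w = "p + g"
      have sum_w: "sum ?w {..<n} = Suc r * n"
        using g p by (simp add: sum.distrib gens_def)
      have le: "p \<le> ?w" "?w \<le> q"
        using g(2) pq'(3) by (auto simp: le_fun_def) (metis add.commute le_diff_conv2)
      have diff: "?w - p \<noteq> all_ones n" "q - ?w \<noteq> all_ones n"
        using g by (auto simp: gens_def fun_diff_def)
      \<comment> \<open>Only rank 1 is critical: there \<open>p = 0\<close>, so \<open>?w\<close> is
        the generator \<open>g\<close> itself.\<close>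
      have "?w \<noteq> all_ones n"
      proof
        assume "?w = all_ones n"
        then have "r * n + n = n"
          using sum_w by simp
        then have "p = 0"
          using p(2) V(1) vector_eqI[of 0 n p] by (auto simp: le_fun_def nat_vectors_def)
        then show False
          using \<open>?w = all_ones n\<close> g(1) by (simp add: gens_def)
      qed
      then have wV: "?w \<in> pinched_veronese n"
        using sum_w V(1) g(1) by (simp add: pinched_veronese_def nat_vectors_def gens_def del: plus_fun_apply) (simp add: dvd_def)
      have pw: "(p, ?w) \<in> pinched_veronese_order n" and wq: "(?w, q) \<in> pinched_veronese_order n"
        using le diff pq' wV by (auto simp: pinched_veronese_order_iff I_iff)
      have "?w \<in> I"
        using pinched_veronese_order_trans[OF _ wq, of z] pinched_veronese_order_trans[OF _ _ pw, of 0]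
          pq'(1,2) n unfolding I_def order_interval_def by simp
      then have R: "(p, ?w) \<in> R" "(?w, q) \<in> R"
        using pw wq pq' by (auto simp: R_def)
      have "?w \<in> C"
      proof (rule maximal_chain_insert[OF C \<open>?w \<in> I\<close>])
        fix c assume c: "c \<in> C"
        show "(c, ?w) \<in> R \<or> (?w, c) \<in> R"
        \<comment> \<open>Chain elements in \<open>B\<close> lie above \<open>q\<close>, the others
          below \<open>p\<close>; transitivity compares them with \<open>?w\<close>.\<close>
        proof (cases "c \<in> B")
          case True
          then have "c = q" if "(c, q) \<in> R"
            using that q(2)[of c] R_sum_le[of c q] R_sum_eq[of c q] by simp
          then have "(q, c) \<in> R"
            using comparable[OF \<open>q \<in> C\<close> c] R_refl[OF pq'(2)] by blast
          then show ?thesis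
            using R R_trans by blast
        next
          case False
          then have "sum c {..<n} \<le> r * n"
            using c by (simp add: B_def)
          then have "c = p" if "(p, c) \<in> R"
            using that p(2) R_sum_le[of p c] R_sum_eq[of c p] by simp
          then have "(c, p) \<in> R"
            using comparable[OF p(1) c] R_refl[OF pq'(1)] by blast
          then show ?thesis
            using R R_trans by blast
        qed
      qed
      then show False
        using missing sum_w by blast
    qed
  }
qed

lemma maximal_chain_saturated:
  assumes C: "C \<in> maximal_chains R"
  shows "\<exists>x\<in>saturated n k z. C = x ` {..k}"
proof -
  have comparable: "(a, b) \<in> R \<or> (b, a) \<in> R" if "a \<in> C" "b \<in> C" for a b
    using C that by (auto simp: maximal_chains_def Chains_def)
  then have CI: "C \<subseteq> I"
    using R_iff by blast
  obtain x' where x': "\<And>r. r \<le> k \<Longrightarrow> x' r \<in> C \<and> sum (x' r) {..<n} = r * n"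
    using maximal_chain_rank[OF C] by metis
  have unique: "a = x' r" if "a \<in> C" "sum a {..<n} = r * n" "r \<le> k" for a r
    using that x'[of r] comparable[of a "x' r"] R_sum_eq[of a "x' r"] by simp
  define x where "x = (\<lambda>r. if r \<le> k then x' r else z)"
  have xC: "x r \<in> C" "sum (x r) {..<n} = r * n" if "r \<le> k" for r
    using x' that by (auto simp: x_def)
  have "C = x ` {..k}"
  proof
    show "C \<subseteq> x ` {..k}"
    proof
      fix a assume "a \<in> C"
      moreover from this obtain r where r: "r \<le> k" "sum a {..<n} = r * n"
        using CI I_sum by blast
      ultimately have "a = x r"
        using unique by (simp add: x_def)
      then show "a \<in> x ` {..k}"
        using r by simp
    qed
  qed (use xC in auto)
  moreover have "x \<in> saturated n k z"
    unfolding saturated_def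
  proof (intro CollectI conjI allI impI)
    have V: "x r \<in> nat_vectors n" "x r \<le> z" if "r \<le> k" for r
      using xC[OF that] CI by (auto simp: I_iff pinched_veronese_def)
    show "x 0 = 0"
      using xC[of 0] V[of 0] vector_eqI[of 0 n "x 0"] by (auto simp: le_fun_def nat_vectors_def)
    have "x k = z"
      using xC[of k] V[of k] vector_eqI[of "x k" n z] z sum_z by (auto simp: pinched_veronese_def)
    then show "x r = z" if "k \<le> r" for r
      using that by (cases "r = k") (auto simp: x_def)
    fix r assume r: "r < k"
    have R: "(x r, x (Suc r)) \<in> R"
      using comparable[of "x r" "x (Suc r)"] xC[of r] xC[of "Suc r"] R_sum_le[of "x (Suc r)" "x r"] n r
      by auto
    then show le: "x r \<le> x (Suc r)"
      by (simp add: R_iff)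
    have "sum (x (Suc r) - x r) {..<n} = n"
      using xC[of r] xC[of "Suc r"] r le by (simp add: le_fun_def sum_subtractf_nat)
    then show "x (Suc r) - x r \<in> gens n"
      using R V[of r] V[of "Suc r"] r by (simp add: gens_def R_iff nat_vectors_def)
  qed
  ultimately show ?thesis
    by blast
qed

lemma maximal_chains_eq: "maximal_chains R = (\<lambda>x. x ` {..k}) ` saturated n k z"
  using maximal_chain_saturated saturated_maximal by blast

lemma inj_saturated: "inj_on (\<lambda>x. x ` {..k}) (saturated n k z)"
proof (rule inj_onI)
  fix x y assume x: "x \<in> saturated n k z" and y: "y \<in> saturated n k z" and eq: "x ` {..k} = y ` {..k}"
  show "x = y"
  proof
    fix r
    show "x r = y r"
    proof (cases "r \<le> k")
      case True
      then obtain s where "s \<le> k" "x r = y s"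
        using eq by (metis (no_types, lifting) atMost_iff imageE imageI)
      then show ?thesis
        using saturated_eq_rank[OF x y _ True] by metis
    next
      case False
      then show ?thesis
        using x y by (simp add: saturated_def)
    qed
  qed
qed

section \<open>Finiteness, gradedness and the shelling of the interval\<close>

lemma finite_maximal_chains: "finite (maximal_chains R)"
proof (rule finite_subset)
  show "maximal_chains R \<subseteq> Pow I"
    by (auto simp: maximal_chains_def Chains_def R_iff)
qed (simp add: finite_I)

lemma finite_saturated: "finite (saturated n k z)"
  using finite_maximal_chains inj_saturated unfolding maximal_chains_eq by (rule finite_imageD)

lemma card_maximal_chain: "C \<in> maximal_chains R \<Longrightarrow> card C = Suc k"
proof -
  assume "C \<in> maximal_chains R"
  then obtain x where x: "x \<in> saturated n k z" "C = x ` {..k}"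
    using maximal_chain_saturated by blast
  then have "inj_on x {..k}"
    using saturated_eq_rank[OF x(1) x(1)] by (auto intro: inj_onI)
  then show ?thesis
    using x by (simp add: card_image)
qed

text \<open>Without such an exchange \<open>x\<close> is normal off the ranks shared with
  \<open>y\<close>. Any key-minimal chain through the shared elements is normal off them too, hence
  equal to \<open>x\<close>; and \<open>y\<close>, with a key no larger, would be minimal as
  well.\<close>

lemma saturated_exchange:
  assumes x: "x \<in> saturated n k z" and y: "y \<in> saturated n k z" and "x \<noteq> y" "key n k y \<le> key n k x"
  shows "\<exists>r w. Suc r < k \<and> x (Suc r) \<noteq> y (Suc r) \<and> x(Suc r := w) \<in> saturated n k z \<and>
    key n k (x(Suc r := w)) < key n k x"
proof (rule ccontr)
  assume contra: "\<not> ?thesis"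
  define Y where "Y = {r. x r = y r}"
  have Y: "0 \<in> Y" "k \<in> Y"
    using saturated_ends[OF x] saturated_ends[OF y] by (simp_all add: Y_def)
  have normal_x: "normal_off Y k x"
    unfolding normal_off_def Y_def mem_Collect_eq using contra saturated_improves[OF x] by blast
  define S where "S = {w \<in> saturated n k z. \<forall>r\<in>Y. w r = x r}"
  have S: "finite S" "x \<in> S" "y \<in> S"
    using finite_saturated x y by (auto simp: S_def Y_def)
  have minimal_normal: "w = x" if w: "w \<in> S" and min: "\<And>v. v \<in> S \<Longrightarrow> key n k w \<le> key n k v" for w
  proof -
    have "normal_off Y k w"
      unfolding normal_off_def
    proof (intro allI impI, rule ccontr)
      fix r assume r: "Suc r < k" "Suc r \<notin> Y" "\<not> good (step w r) (step w (Suc r))"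
      then obtain v where "w(Suc r := v) \<in> saturated n k z" "key n k (w(Suc r := v)) < key n k w"
        using saturated_improves[of w n k z r] w by (auto simp: S_def)
      \<comment> \<open>The improvement changes an unpinned rank only, so the shared elements are
        kept.\<close>
      moreover from this have "w(Suc r := v) \<in> S"
        using w r by (auto simp: S_def)
      ultimately show False
        using min leD by blast
    qed
    then show ?thesis
      using normal_off_unique[OF n _ x Y _ _ normal_x] w by (simp add: S_def)
  qed
  define w where "w = arg_min_on (key n k) S"
  have "w \<in> S" "\<And>v. v \<in> S \<Longrightarrow> key n k w \<le> key n k v"
    unfolding w_def using S arg_min_if_finite(1)[of S "key n k"] arg_min_least[of S _ "key n k"] by auto
  then have "\<And>v. v \<in> S \<Longrightarrow> key n k x \<le> key n k v"
    using minimal_normal by metis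
  then have "y = x"
    using S assms(4) by (intro minimal_normal) (auto intro: order_trans)
  then show False
    using \<open>x \<noteq> y\<close> by simp
qed

lemma ex_shelling: "\<exists>L. shelling_order R L"
proof (rule ex_shelling_order[OF finite_maximal_chains])
  let ?f = "\<lambda>x. x ` {..k}"
  \<comment> \<open>Injectivity of \<open>?f\<close> lets the key of sequences be read off from
    chains.\<close>
  let ?key = "\<lambda>c. key n k (inv_into (saturated n k z) ?f c)"
  have key: "?key (?f x) = key n k x" if "x \<in> saturated n k z" for x
    using inv_into_f_f[OF inj_saturated that] by simp
  fix c c' assume "c \<in> maximal_chains R" "c' \<in> maximal_chains R" "c \<noteq> c'" and le: "?key c' \<le> ?key c"
  then obtain x y where x: "x \<in> saturated n k z" "c = ?f x" and y: "y \<in> saturated n k z" "c' = ?f y"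
    using maximal_chain_saturated by metis
  moreover have "x \<noteq> y" "key n k y \<le> key n k x"
    using x y \<open>c \<noteq> c'\<close> le key by auto
  ultimately obtain r w where r: "Suc r < k" "x (Suc r) \<noteq> y (Suc r)"
    and xw: "x(Suc r := w) \<in> saturated n k z" "key n k (x(Suc r := w)) < key n k x"
    using saturated_exchange by blast
  define v where "v = x(Suc r := w)"
  have "w \<noteq> x (Suc r)"
    using xw(2) by auto
  \<comment> \<open>An element has the same rank in every chain, so \<open>w\<close> could only be
    the replaced element, from which it differs.\<close>
  have w: "w \<notin> c"
  proof
    assume "w \<in> c"
    then obtain s where "w = x s" "s \<le> k"
      using x(2) by auto
    then show False
      using saturated_eq_rank[OF xw(1) x(1), of "Suc r" s] r \<open>w \<noteq> x (Suc r)\<close> by simp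
  qed
  let ?rest = "x ` ({..k} - {Suc r})"
  have d: "?f v = insert w ?rest"
    using r by (auto simp: v_def image_iff)
  have c: "c = insert (x (Suc r)) ?rest"
    using r by (subst x(2)) (auto simp: image_iff)
  have xr: "x (Suc r) \<notin> ?rest"
  proof
    assume "x (Suc r) \<in> ?rest"
    then obtain s where "x (Suc r) = x s" "s \<le> k" "s \<noteq> Suc r"
      by auto
    then show False
      using saturated_eq_rank[OF x(1) x(1), of "Suc r" s] r by simp
  qed
  have "w \<notin> ?rest"
    using w c by simp
  then have "sym_diff c (?f v) = {x (Suc r), w}"
    using xr \<open>w \<noteq> x (Suc r)\<close> unfolding d by (subst (1 2) c) auto
  then have "card (sym_diff c (?f v)) = 2"
    using \<open>w \<noteq> x (Suc r)\<close> by simp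
  \<comment> \<open>Shared elements sit at the same rank in \<open>x\<close> and \<open>y\<close>,
    whereas \<open>x\<close> and \<open>y\<close> differ at the replaced rank.\<close>
  moreover have "c \<inter> c' \<subseteq> ?f v"
  proof
    fix a assume "a \<in> c \<inter> c'"
    then have "a \<in> ?f x" "a \<in> ?f y"
      using x(2) y(2) by simp_all
    then obtain s t where st: "a = x s" "a = y t" "s \<le> k" "t \<le> k"
      by blast
    then have "s = t"
      using saturated_eq_rank[OF x(1) y(1), of s t] by simp
    then have "s \<noteq> Suc r"
      using r(2) st by auto
    then have "a \<in> ?rest"
      using st by blast
    then show "a \<in> ?f v"
      using d by blast
  qed
  moreover have "?f v \<in> maximal_chains R" "?key (?f v) < ?key c"
    using xw x(2) key[OF x(1)] key[of v] saturated_maximal[of v] unfolding v_def[symmetric] by simp_all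
  ultimately show "\<exists>d\<in>maximal_chains R. ?key d < ?key c \<and> c \<inter> c' \<subseteq> d \<and> card (sym_diff c d) = 2"
    by blast
qed

lemma shellable: "shellable_poset I R"
proof -
  have "bounded_poset I R"
    using partial_order_R zero_R R_top zero_I top_I unfolding bounded_poset_def by blast
  moreover have "graded_poset I R"
    using partial_order_R card_maximal_chain by (simp add: graded_poset_def)
  ultimately show ?thesis
    using finite_I ex_shelling by (simp add: shellable_poset_def)
qed

end

theorem theorem1:
  fixes n :: nat and z :: "nat \<Rightarrow> nat"
  assumes "n \<ge> 4" and "z \<in> pinched_veronese n"
  shows "shellable_poset (order_interval (pinched_veronese_order n) 0 z)
           (Restr (pinched_veronese_order n) (order_interval (pinched_veronese_order n) 0 z))"
proof -
  obtain k where "sum z {..<n} = k * n"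
    using assms(2) by (auto simp: pinched_veronese_def dvd_def mult.commute)
  then interpret pinched_interval n k z
    using assms by unfold_locales
  show ?thesis
    using shellable by (simp add: R_def I_def)
qed

end
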